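(* Let $(h,\boldsymbol{\omega},\boldsymbol{v})$ be a trajectory of the quadrotor dynamics on $SE(3)$ described in the context, with input $\boldsymbol{\mu}$ whose norm is bounded. Let $\omega_0,v_0>0$ be constants with $\omega_0>\sqrt2\max|\boldsymbol{\omega}|$ and $v_0>\max|\boldsymbol{v}|$, where the maxima are over the admissible values of the velocities. Let $s_0=\max\{\omega_0,v_0\}$, $\widehat{\boldsymbol{\omega}}=\boldsymbol{\omega}/\omega_0$, $\widehat{\boldsymbol{v}}=\boldsymbol{v}/v_0$, and for $k=0,1,2,\dots$ let $$\widehat g_k=\frac{hS^k}{s_0^k},\qquad \widehat f_k=\frac{(\omega^\times)^k\boldsymbol{v}}{\omega_0^k v_0}=(\widehat\omega^\times)^k\widehat{\boldsymbol{v}},\qquad \underline{\widehat g}_k=\mathrm{vec}(\widehat g_k).$$ Let $\bar\omega<1/\sqrt2$ and $\bar v<1$ be constants and let $\mathcal{D}_{\widehat\omega}=\{\widehat{\boldsymbol{\omega}}\in\mathbb{R}^3:|\widehat{\boldsymbol{\omega}}|\le\bar\omega\}$, $\mathcal{D}_{\widehat v}=\{\widehat{\boldsymbol{v}}\in\mathbb{R}^3:|\widehat{\boldsymbol{v}}|\le\bar v\}$. Let a dot denote the time derivative along the trajectory. Then at every time $t$ at which $\widehat{\boldsymbol{\omega}}(t)\in\mathcal{D}_{\widehat\omega}$ and $\widehat{\boldsymbol{v}}(t)\in\mathcal{D}_{\widehat v}$ (with $h(t)\in SE(3)$ arbitrary), $$\lim_{k\to\infty}\underline{\widehat g}_k(t)=\mathbf{0},\quad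 \lim_{k\to\infty}\dot{\underline{\widehat g}}_k(t)=\mathbf{0},\quad \lim_{k\to\infty}\widehat f_k(t)=\mathbf{0},\quad \lim_{k\to\infty}\dot{\widehat f}_k(t)=\mathbf{0}.$$
   Context: $|\cdot|$ is the Euclidean norm. For $\boldsymbol{a}\in\mathbb{R}^3$, $a^\times\in\mathbb{R}^{3\times3}$ is the skew-symmetric matrix with $a^\times\boldsymbol{b}=\boldsymbol{a}\times\boldsymbol{b}$ for all $\boldsymbol{b}\in\mathbb{R}^3$. For a matrix $A$, $\mathrm{vec}(A)$ is the vector obtained by stacking its columns. $SE(3)$ is the set of $4\times4$ matrices $h=\begin{bmatrix}R&\boldsymbol{p}\\ \mathbf{0}&1\end{bmatrix}$ with $R\in SO(3)$ and $\boldsymbol{p}\in\mathbb{R}^3$. Quadrotor dynamics: the state is $h\in SE(3)$ (attitude $R$ and position $\boldsymbol{p}$), the angular velocity $\boldsymbol{\omega}\in\mathbb{R}^3$ and the linear velocity $\boldsymbol{v}\in\mathbb{R}^3$, both in the body-fixed frame. With $$S=\begin{bmatrix}\omega^\times&\boldsymbol{v}\\ \mathbf{0}&0\end{bmatrix}\in\mathbb{R}^{4\times4},$$ a trajectory is a triple of differentiable functions of time satisfying $$\dot h=hS,\qquad J\dot{\boldsymbol{\omega}}=\boldsymbol{\mu},\qquad \dot{\boldsymbol{v}}=\tfrac1m F\boldsymbol{e}_3-\omega^\times\boldsymbol{v}-g R^{\mathrm T}\boldsymbol{e}_3 .$$ Here $J\in\mathbb{R}^{3\times3}$ is the positive definite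 inertia matrix, $m>0$ the mass, $g$ the (scalar) gravitational acceleration, $\boldsymbol{e}_3=[0,0,1]^{\mathrm T}$, $F(t)\in\mathbb{R}$ the total thrust, and $\boldsymbol{\mu}(t)\in\mathbb{R}^3$ the modified control input (the whole right-hand side of the rotational equation). $F$ and $\boldsymbol{\mu}$ are given functions of time. *)

theory Defs
  imports "HOL-Analysis.Analysis"
begin

(* The operations * and ^ on real^'n^'n are componentwise, so matrix powers
   have to be built from the matrix product. *)
primrec matrix_pow :: "real^'n^'n \<Rightarrow> nat \<Rightarrow> real^'n^'n" where
  "matrix_pow A 0 = mat 1"
| "matrix_pow A (Suc k) = A ** matrix_pow A k"

(* Positive definiteness of a real matrix includes symmetry. *)
definition pos_definite :: "real^'n^'n \<Rightarrow> bool" where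
  "pos_definite A \<longleftrightarrow> transpose A = A \<and> (\<forall>x. x \<noteq> 0 \<longrightarrow> 0 < x \<bullet> (A *v x))"

definition skew :: "real^3 \<Rightarrow> real^3^3" where
  "skew a = matrix (cross3 a)"

lemma skew_mult_vec: "skew a *v b = cross3 a b"
  by (simp add: skew_def cross_mult_right cross_add_right linearI)

(* The block matrix [M, p; 0, c] *)
definition block_mat :: "real^3^3 \<Rightarrow> real^3 \<Rightarrow> real \<Rightarrow> real^4^4" where
  "block_mat M p c = vector
     [vector [M$1$1, M$1$2, M$1$3, p$1],
      vector [M$2$1, M$2$2, M$2$3, p$2],
      vector [M$3$1, M$3$2, M$3$3, p$3],
      vector [0,     0,     0,     c]]"

definition SE3 :: "(real^4^4) set" where
  "SE3 = {block_mat R p 1 | R p. rotation_matrix R}"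

definition attitude :: "real^4^4 \<Rightarrow> real^3^3" where
  "attitude h = vector
     [vector [h$1$1, h$1$2, h$1$3],
      vector [h$2$1, h$2$2, h$2$3],
      vector [h$3$1, h$3$2, h$3$3]]"

lemma attitude_block_mat [simp]: "attitude (block_mat R p c) = R"
  by (simp add: attitude_def block_mat_def vector_def vec_eq_iff forall_3)

definition twist :: "real^3 \<Rightarrow> real^3 \<Rightarrow> real^4^4" where
  "twist \<omega> v = block_mat (skew \<omega>) v 0"

definition stack_columns :: "real^4^4 \<Rightarrow> real^16" where
  "stack_columns A = vector
     [A$1$1, A$2$1, A$3$1, A$4$1,
      A$1$2, A$2$2, A$3$2, A$4$2,
      A$1$3, A$2$3, A$3$3, A$4$3,
      A$1$4, A$2$4, A$3$4, A$4$4]"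

(* T is the time interval; the derivatives at its end points, if any, are one-sided. *)
definition quadrotor_trajectory ::
  "real set \<Rightarrow> real^3^3 \<Rightarrow> real \<Rightarrow> real \<Rightarrow> (real \<Rightarrow> real) \<Rightarrow> (real \<Rightarrow> real^3) \<Rightarrow>
   (real \<Rightarrow> real^4^4) \<Rightarrow> (real \<Rightarrow> real^3) \<Rightarrow> (real \<Rightarrow> real^3) \<Rightarrow> bool" where
  "quadrotor_trajectory T J m g F \<mu> h \<omega> v \<longleftrightarrow>
     (\<forall>t\<in>T. h t \<in> SE3 \<and>
        (h has_vector_derivative h t ** twist (\<omega> t) (v t)) (at t within T) \<and>
        (\<exists>\<omega>'. (\<omega> has_vector_derivative \<omega>') (at t within T) \<and> J *v \<omega>' = \<mu> t) \<and>
        (v has_vector_derivative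
           (F t / m) *\<^sub>R axis 3 1 - skew (\<omega> t) *v v t
             - g *\<^sub>R (transpose (attitude (h t)) *v axis 3 1)) (at t within T))"

definition is_max :: "real \<Rightarrow> real set \<Rightarrow> bool" where
  "is_max M A \<longleftrightarrow> M \<in> A \<and> (\<forall>x\<in>A. x \<le> M)"

definition ghat :: "real \<Rightarrow> real^4^4 \<Rightarrow> real^3 \<Rightarrow> real^3 \<Rightarrow> nat \<Rightarrow> real^4^4" where
  "ghat s0 h \<omega> v k = (1 / s0 ^ k) *\<^sub>R (h ** matrix_pow (twist \<omega> v) k)"

definition fhat :: "real \<Rightarrow> real \<Rightarrow> real^3 \<Rightarrow> real^3 \<Rightarrow> nat \<Rightarrow> real^3" where
  "fhat \<omega>0 v0 \<omega> v k = (1 / (\<omega>0 ^ k * v0)) *\<^sub>R (matrix_pow (skew \<omega>) k *v v)"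

lemma skew_scaleR: "skew (c *\<^sub>R a) = c *\<^sub>R skew a"
  by (simp add: matrix_eq skew_mult_vec scaleR_matrix_vector_assoc[symmetric] cross_mult_left)

lemma matrix_pow_scaleR: "matrix_pow (c *\<^sub>R A) k = c ^ k *\<^sub>R matrix_pow A k"
  by (induction k)
     (simp_all add: matrix_matrix_mult_def vec_eq_iff sum_distrib_left ac_simps)

lemma fhat_normalized:
  "fhat \<omega>0 v0 \<omega> v k = matrix_pow (skew (\<omega> /\<^sub>R \<omega>0)) k *v (v /\<^sub>R v0)"
  by (simp add: fhat_def skew_scaleR matrix_pow_scaleR scaleR_matrix_vector_assoc[symmetric]
      matrix_vector_mult_scaleR field_simps)

end

theory Submission
  imports Defs
begin

text \<open>
  Both \<open>\<omega>\<^sup>\<times>\<close> and the twist \<open>S\<close> satisfy \<open>A\<^sup>4 = - |\<omega>|\<^sup>2 A\<^sup>2\<close>. After normalisation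
  \<open>|\<omega>| < 1\<close>, so the powers of \<open>A\<close> decay geometrically, say like \<open>r\<^sup>k\<close>, whatever the linear
  velocity is. The derivative of \<open>A\<^sup>k\<close> is the sum of the \<open>k\<close> terms \<open>A\<^sup>i A' A\<^bsup>k-1-i\<^esup>\<close>, hence it is
  \<open>O(k r\<^bsup>k-1\<^esup>)\<close> and tends to zero too. All four sequences are images of \<open>A\<^sup>k\<close> and of its derivative
  under fixed bounded bilinear maps.
\<close>

section \<open>Matrix products and the derivative of a matrix power\<close>

text \<open>In finite dimension bilinearity already implies boundedness. This supplies the product
  rule, the limits of products and a constant for the norm of a product.\<close>

lemma bounded_bilinear_matrix_matrix_mult:
  "bounded_bilinear ((**) :: real^'n^'m \<Rightarrow> real^'p^'n \<Rightarrow> real^'p^'m)"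
  by (subst bilinear_conv_bounded_bilinear[symmetric])
     (auto simp: bilinear_def matrix_matrix_mult_def vec_eq_iff algebra_simps sum.distrib
       sum_distrib_left intro!: linearI)

lemma bounded_bilinear_matrix_vector_mult:
  "bounded_bilinear ((*v) :: real^'n^'m \<Rightarrow> real^'n \<Rightarrow> real^'m)"
  by (subst bilinear_conv_bounded_bilinear[symmetric])
     (auto simp: bilinear_def matrix_vector_mult_def vec_eq_iff algebra_simps sum.distrib
       sum_distrib_left intro!: linearI)

text \<open>The non-commutative Leibniz sum, kept in closed form so that its summands can be bounded
  one by one.\<close>

definition matrix_pow_deriv :: "real^'n^'n \<Rightarrow> real^'n^'n \<Rightarrow> nat \<Rightarrow> real^'n^'n" where
  "matrix_pow_deriv A A' k = (\<Sum>i<k. matrix_pow A i ** (A' ** matrix_pow A (k - Suc i)))"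

text \<open>The summand \<open>i = 0\<close> is \<open>A' ** matrix_pow A k\<close>; all others have
  a left factor \<open>A\<close>. This is the shape the product rule gives for
  \<open>A ** matrix_pow A k\<close>.\<close>

lemma matrix_pow_deriv_Suc:
  "matrix_pow_deriv A A' (Suc k) = A ** matrix_pow_deriv A A' k + A' ** matrix_pow A k"
  unfolding matrix_pow_deriv_def sum.lessThan_Suc_shift
  by (simp add: bounded_bilinear.sum_right[OF bounded_bilinear_matrix_matrix_mult]
      matrix_mul_assoc)

lemma has_vector_derivative_matrix_pow:
  assumes "(A has_vector_derivative A') (at t within T)"
  shows "((\<lambda>\<tau>. matrix_pow (A \<tau>) k) has_vector_derivative matrix_pow_deriv (A t) A' k)
           (at t within T)"
proof (induction k)
  case 0
  then show ?case
    by (simp add: matrix_pow_deriv_def)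
next
  case (Suc k)
  from bounded_bilinear.has_vector_derivative[OF bounded_bilinear_matrix_matrix_mult assms Suc]
  show ?case
    by (simp add: matrix_pow_deriv_Suc)
qed

section \<open>Geometric decay of powers and of their derivatives\<close>

text \<open>From the exponent 4 on, two further factors \<open>A\<close> amount to the scalar
  \<open>c\<close>, so the decay rate per factor is at most any \<open>r\<close> above
  \<open>sqrt \<bar>c\<bar>\<close>.\<close>

lemma matrix_pow_geometric_bound:
  assumes quartic: "matrix_pow A 4 = c *\<^sub>R matrix_pow A 2" and c: "\<bar>c\<bar> < 1"
  obtains C r where "0 \<le> C" "0 < r" "r < 1" "\<And>k. norm (matrix_pow A k) \<le> C * r ^ k"
proof -
  have "sqrt \<bar>c\<bar> < 1"
    using c by simp
  \<comment> \<open>The strict lower bound keeps \<open>r\<close> positive even for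
    \<open>c = 0\<close>, so division by powers of \<open>r\<close> is safe.\<close>
  then obtain r where r: "sqrt \<bar>c\<bar> < r" "r < 1"
    using dense by blast
  have r0: "0 < r"
    by (intro le_less_trans[OF _ r(1)]) simp
  have cr: "\<bar>c\<bar> \<le> r\<^sup>2"
    using r r0 by (metis less_imp_le real_sqrt_le_iff real_sqrt_abs abs_of_pos)
  \<comment> \<open>The sum dominates each of its four terms, which settles the exponents that the
    recursion does not reach.\<close>
  define C where "C = (\<Sum>j<4. norm (matrix_pow A j) / r ^ j)"
  have C0: "0 \<le> C"
    unfolding C_def using r0 by (intro sum_nonneg) auto
  have shift: "matrix_pow A (k + 4) = c *\<^sub>R matrix_pow A (k + 2)" for k
    by (induction k)
       (simp_all only: add_0 quartic add_Suc matrix_pow.simps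
         bounded_bilinear.scaleR_right[OF bounded_bilinear_matrix_matrix_mult])
  have "norm (matrix_pow A k) \<le> C * r ^ k" for k
  proof (induction k rule: less_induct)
    case (less k)
    show ?case
    proof (cases "k < 4")
      case True
      then have "norm (matrix_pow A k) / r ^ k \<le> C"
        unfolding C_def using r0 by (intro member_le_sum) auto
      then show ?thesis
        using r0 by (simp add: field_simps)
    next
      case False
      then obtain j where j: "k = j + 4"
        by (metis add.commute le_Suc_ex not_less)
      have "norm (matrix_pow A k) = \<bar>c\<bar> * norm (matrix_pow A (j + 2))"
        unfolding j shift by simp
      also have "\<dots> \<le> r\<^sup>2 * (C * r ^ (j + 2))"
        using less[of "j + 2"] j cr by (intro mult_mono) auto
      also have "\<dots> = C * r ^ k"
        by (simp add: j power_add power2_eq_square numeral_eq_Suc)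
      finally show ?thesis .
    qed
  qed
  with C0 r0 r(2) show thesis
    using that by blast
qed

lemma
  assumes "matrix_pow A 4 = c *\<^sub>R matrix_pow A 2" "\<bar>c\<bar> < 1"
  shows matrix_pow_tendsto_zero: "matrix_pow A \<longlonglongrightarrow> 0"
    and matrix_pow_deriv_tendsto_zero: "matrix_pow_deriv A A' \<longlonglongrightarrow> 0"
proof -
  obtain C r where C: "0 \<le> C" and r: "0 < r" "r < 1"
    and bound: "\<And>k. norm (matrix_pow A k) \<le> C * r ^ k"
    using matrix_pow_geometric_bound[OF assms] by blast
  have "(\<lambda>k. C * r ^ k) \<longlonglongrightarrow> 0"
    using r by (intro tendsto_mult_right_zero LIMSEQ_power_zero) simp
  then show "matrix_pow A \<longlonglongrightarrow> 0"
    by (rule Lim_null_comparison[OF always_eventually[OF allI[OF bound]]])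
  \<comment> \<open>\<open>K\<close> takes the place of submultiplicativity of the norm.\<close>
  obtain K where K: "0 < K"
    and mult: "\<And>(X :: real^'a^'a) (Y :: real^'a^'a). norm (X ** Y) \<le> norm X * norm Y * K"
    using bounded_bilinear.pos_bounded[OF bounded_bilinear_matrix_matrix_mult] by blast
  \<comment> \<open>Two powers of \<open>A\<close> contribute \<open>C\<close> each and two products
    \<open>K\<close> each; \<open>1 / r\<close> appears because the exponents \<open>i\<close> and
    \<open>k - Suc i\<close> add up to \<open>k - 1\<close>.\<close>
  define M where "M = C * (norm A' * C * K) * K / r"
  have term_bound: "norm (matrix_pow A i ** (A' ** matrix_pow A (k - Suc i))) \<le> M * r ^ k"
    if "i < k" for i k
  proof -
    have "norm (A' ** matrix_pow A (k - Suc i)) \<le> norm A' * (C * r ^ (k - Suc i)) * K"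
      using bound[of "k - Suc i"] K
      by (intro order_trans[OF mult] mult_right_mono mult_left_mono) auto
    then have "norm (matrix_pow A i) * norm (A' ** matrix_pow A (k - Suc i))
        \<le> (C * r ^ i) * (norm A' * (C * r ^ (k - Suc i)) * K)"
      using bound[of i] C r by (intro mult_mono) auto
    then have "norm (matrix_pow A i ** (A' ** matrix_pow A (k - Suc i)))
        \<le> (C * r ^ i) * (norm A' * (C * r ^ (k - Suc i)) * K) * K"
      using K by (intro order_trans[OF mult] mult_right_mono) auto
    also have "\<dots> = C * (norm A' * C * K) * K * (r ^ i * r ^ (k - Suc i))"
      by (simp add: mult_ac)
    also have "r ^ i * r ^ (k - Suc i) = r ^ k / r"
    proof -
      have "r ^ k = r * (r ^ i * r ^ (k - Suc i))"
        using that by (simp flip: power_add power_Suc)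
      then show ?thesis
        using r by simp
    qed
    finally show ?thesis
      by (simp add: M_def)
  qed
  have deriv_bound: "norm (matrix_pow_deriv A A' k) \<le> M * (real k * r ^ k)" for k
  proof -
    have "norm (matrix_pow_deriv A A' k) \<le> (\<Sum>i<k. M * r ^ k)"
      unfolding matrix_pow_deriv_def by (rule sum_norm_le) (simp add: term_bound)
    then show ?thesis
      by (simp add: mult_ac)
  qed
  have "(\<lambda>k. M * (real k * r ^ k)) \<longlonglongrightarrow> 0"
    using r by (intro tendsto_mult_right_zero powser_times_n_limit_0) simp
  then show "matrix_pow_deriv A A' \<longlonglongrightarrow> 0"
    by (rule Lim_null_comparison[OF always_eventually[OF allI[OF deriv_bound]]])
qed

section \<open>Quartic identities and linearity of the quadrotor matrices\<close>

lemma skew_entries: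
  "skew a = vector [vector [0, - a$3, a$2], vector [a$3, 0, - a$1], vector [- a$2, a$1, 0]]"
  by (simp add: skew_def matrix_def cross3_def vec_eq_iff forall_3 axis_def)

lemma vector_4_entries:
  "(vector [a, b, c, d] :: 'a::zero^4) $ 1 = a"
  "(vector [a, b, c, d] :: 'a::zero^4) $ 2 = b"
  "(vector [a, b, c, d] :: 'a::zero^4) $ 3 = c"
  "(vector [a, b, c, d] :: 'a::zero^4) $ 4 = d"
  by (simp_all add: vector_def)

lemma matrix_pow_2: "matrix_pow A 2 = A ** A"
  by (simp add: numeral_2_eq_2)

lemma matrix_pow_4: "matrix_pow A 4 = (A ** A) ** (A ** A)"
  by (simp add: numeral_eq_Suc matrix_mul_assoc)

text \<open>By Cayley-Hamilton, \<open>W = skew a\<close> satisfies W^3 = -|a|^2 W; this is that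
  cubic times W, checked entrywise.\<close>

lemma skew_quartic: "matrix_pow (skew a) 4 = (- (norm a)\<^sup>2) *\<^sub>R matrix_pow (skew a) 2"
  unfolding power2_norm_eq_inner matrix_pow_2 matrix_pow_4
  by (simp add: skew_entries matrix_matrix_mult_def vec_eq_iff forall_3 sum_3 inner_vec_def
      algebra_simps)

text \<open>For k >= 1 the k-th power of the twist has the blocks W^k and W^(k-1) b over a zero row,
  where \<open>W = skew a\<close>. The cubic for W thus yields a quartic here, with a factor
  independent of \<open>b\<close>; the cubic itself fails in general.\<close>

lemma twist_quartic: "matrix_pow (twist a b) 4 = (- (norm a)\<^sup>2) *\<^sub>R matrix_pow (twist a b) 2"
  unfolding power2_norm_eq_inner matrix_pow_2 matrix_pow_4
  by (simp add: twist_def block_mat_def skew_entries matrix_matrix_mult_def vec_eq_iff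
      forall_4 sum_4 sum_3 inner_vec_def vector_4_entries algebra_simps)

lemma bounded_linear_skew: "bounded_linear skew"
  unfolding linear_conv_bounded_linear[symmetric]
  by (rule linearI) (simp_all add: skew_entries vec_eq_iff forall_3)

text \<open>The twist is linear in the pair of velocities jointly, so it is differentiated through
  the pair.\<close>

lemma bounded_linear_twist: "bounded_linear (\<lambda>(a, b). twist a b)"
  unfolding linear_conv_bounded_linear[symmetric]
  by (rule linearI) (auto simp: twist_def block_mat_def skew_entries vec_eq_iff forall_4
      vector_4_entries)

lemma twist_scaleR: "twist (c *\<^sub>R a) (c *\<^sub>R b) = c *\<^sub>R twist a b"
  using linear_scale[OF bounded_linear.linear[OF bounded_linear_twist], of c "(a, b)"] by simp

text \<open>Both velocities are divided by the same \<open>s\<close>, so the scalar factor moves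
  into the twist and only a power of one matrix remains.\<close>

lemma ghat_normalized: "ghat s h a b k = h ** matrix_pow (twist (a /\<^sub>R s) (b /\<^sub>R s)) k"
  by (simp add: ghat_def twist_scaleR matrix_pow_scaleR
      bounded_bilinear.scaleR_right[OF bounded_bilinear_matrix_matrix_mult] field_simps)

lemma bounded_linear_stack_columns: "bounded_linear stack_columns"
  unfolding linear_conv_bounded_linear[symmetric]
  by (rule linearI) (simp_all add: stack_columns_def vector_def vec_eq_iff)

section \<open>The four limits along a trajectory\<close>

theorem theorem3:
  fixes T :: "real set"
    and J :: "real^3^3" and m g :: real
    and F :: "real \<Rightarrow> real" and \<mu> :: "real \<Rightarrow> real^3"
    and h :: "real \<Rightarrow> real^4^4" and \<omega> v :: "real \<Rightarrow> real^3"
    and \<Omega>_adm V_adm :: "(real^3) set"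
    and \<omega>_max v_max \<omega>0 v0 s0 \<omega>_bar v_bar :: real
  assumes T: "is_interval T" "interior T \<noteq> {}"
    and J: "pos_definite J"
    and m: "m > 0"
    and traj: "quadrotor_trajectory T J m g F \<mu> h \<omega> v"
    and \<mu>: "bounded (\<mu> ` T)"
    and adm: "\<And>t. t \<in> T \<Longrightarrow> \<omega> t \<in> \<Omega>_adm" "\<And>t. t \<in> T \<Longrightarrow> v t \<in> V_adm"
    and max: "is_max \<omega>_max (norm ` \<Omega>_adm)" "is_max v_max (norm ` V_adm)"
    and pos: "\<omega>0 > 0" "v0 > 0"
    and bounds: "\<omega>0 > sqrt 2 * \<omega>_max" "v0 > v_max"
    and s0: "s0 = max \<omega>0 v0"
    and bar: "\<omega>_bar < 1 / sqrt 2" "v_bar < 1"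
  shows "\<forall>t\<in>T. \<omega> t /\<^sub>R \<omega>0 \<in> {w. norm w \<le> \<omega>_bar} \<and> v t /\<^sub>R v0 \<in> {w. norm w \<le> v_bar} \<longrightarrow>
     (let G = (\<lambda>k \<tau>. stack_columns (ghat s0 (h \<tau>) (\<omega> \<tau>) (v \<tau>) k));
          f = (\<lambda>k \<tau>. fhat \<omega>0 v0 (\<omega> \<tau>) (v \<tau>) k)
      in (\<lambda>k. G k t) \<longlonglongrightarrow> 0 \<and>
         (\<forall>k. G k differentiable (at t within T)) \<and>
         (\<lambda>k. vector_derivative (G k) (at t within T)) \<longlonglongrightarrow> 0 \<and>
         (\<lambda>k. f k t) \<longlonglongrightarrow> 0 \<and>
         (\<forall>k. f k differentiable (at t within T)) \<and>
         (\<lambda>k. vector_derivative (f k) (at t within T)) \<longlonglongrightarrow> 0)"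
proof (intro ballI impI)
  fix t
  assume t: "t \<in> T"
    and dom: "\<omega> t /\<^sub>R \<omega>0 \<in> {w. norm w \<le> \<omega>_bar} \<and> v t /\<^sub>R v0 \<in> {w. norm w \<le> v_bar}"
  \<comment> \<open>A connected set with more than one point has no isolated points, so derivatives
    within \<open>T\<close> are unique and \<open>vector_derivative\<close> returns them.\<close>
  have "T \<noteq> {a}" for a
    using T(2) by auto
  then have nontriv: "at t within T \<noteq> bot"
    using connected_imp_perfect[of T t] T(1) t
    by (auto simp: is_interval_connected trivial_limit_within)
  obtain h' \<omega>' v' where
    h': "(h has_vector_derivative h') (at t within T)" and
    \<omega>': "(\<omega> has_vector_derivative \<omega>') (at t within T)" and
    v': "(v has_vector_derivative v') (at t within T)"
    using traj t unfolding quadrotor_trajectory_def by meson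
  have s0_pos: "0 < s0" and s0_ge: "\<omega>0 \<le> s0"
    using s0 pos by auto
  have "\<omega>_bar < 1"
    using bar(1) by (rule less_le_trans) simp
  then have \<omega>_small: "norm (\<omega> t /\<^sub>R \<omega>0) < 1"
    using dom by auto
  \<comment> \<open>The twist is scaled by \<open>s0\<close> instead of \<open>\<omega>0\<close>; as
    \<open>\<omega>0 \<le> s0\<close>, the scaled angular velocity stays in the open unit
    ball.\<close>
  then have "norm (\<omega> t) < \<omega>0"
    using pos by (simp add: field_simps)
  then have "norm (\<omega> t /\<^sub>R s0) < 1"
    using s0_ge s0_pos by (simp add: field_simps)
  define A where "A = (\<lambda>\<tau>. twist (\<omega> \<tau> /\<^sub>R s0) (v \<tau> /\<^sub>R s0))"
  \<comment> \<open>With the time \<open>t\<close> fixed, this is a constant matrix independent of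
    \<open>k\<close>, as the decay of \<open>matrix_pow_deriv\<close> requires.\<close>
  define A' where "A' = twist (\<omega>' /\<^sub>R s0) (v' /\<^sub>R s0)"
  define B where "B = (\<lambda>\<tau>. skew (\<omega> \<tau> /\<^sub>R \<omega>0))"
  define B' where "B' = skew (\<omega>' /\<^sub>R \<omega>0)"
  have A: "(A has_vector_derivative A') (at t within T)"
    using bounded_linear.has_vector_derivative[OF bounded_linear_twist
        has_vector_derivative_Pair[OF
          bounded_linear.has_vector_derivative[OF bounded_linear_scaleR_right \<omega>']
          bounded_linear.has_vector_derivative[OF bounded_linear_scaleR_right v']]]
    by (simp add: A_def A'_def)
  have B: "(B has_vector_derivative B') (at t within T)"
    unfolding B_def B'_def
    by (intro bounded_linear.has_vector_derivative[OF bounded_linear_skew]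
        bounded_linear.has_vector_derivative[OF bounded_linear_scaleR_right] \<omega>')
  have A_quartic: "matrix_pow (A t) 4 = (- (norm (\<omega> t /\<^sub>R s0))\<^sup>2) *\<^sub>R matrix_pow (A t) 2"
    unfolding A_def by (rule twist_quartic)
  have B_quartic: "matrix_pow (B t) 4 = (- (norm (\<omega> t /\<^sub>R \<omega>0))\<^sup>2) *\<^sub>R matrix_pow (B t) 2"
    unfolding B_def by (rule skew_quartic)
  have A_contr: "\<bar>- (norm (\<omega> t /\<^sub>R s0))\<^sup>2\<bar> < 1"
    using \<open>norm (\<omega> t /\<^sub>R s0) < 1\<close> by (simp add: abs_square_less_1)
  have B_contr: "\<bar>- (norm (\<omega> t /\<^sub>R \<omega>0))\<^sup>2\<bar> < 1"
    using \<omega>_small by (simp add: abs_square_less_1)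
  note A_lims = matrix_pow_tendsto_zero[OF A_quartic A_contr]
    matrix_pow_deriv_tendsto_zero[OF A_quartic A_contr, of A']
  note B_lims = matrix_pow_tendsto_zero[OF B_quartic B_contr]
    matrix_pow_deriv_tendsto_zero[OF B_quartic B_contr, of B']
  define G where "G = (\<lambda>k \<tau>. stack_columns (ghat s0 (h \<tau>) (\<omega> \<tau>) (v \<tau>) k))"
  define f where "f = (\<lambda>k \<tau>. fhat \<omega>0 v0 (\<omega> \<tau>) (v \<tau>) k)"
  have G_eq: "G = (\<lambda>k \<tau>. stack_columns (h \<tau> ** matrix_pow (A \<tau>) k))"
    by (simp add: G_def A_def ghat_normalized)
  have f_eq: "f = (\<lambda>k \<tau>. matrix_pow (B \<tau>) k *v (v \<tau> /\<^sub>R v0))"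
    by (simp add: f_def B_def fhat_normalized)
  have G_deriv: "(G k has_vector_derivative
      stack_columns (h t ** matrix_pow_deriv (A t) A' k + h' ** matrix_pow (A t) k)) (at t within T)"
    for k
    unfolding G_eq
    by (intro bounded_linear.has_vector_derivative[OF bounded_linear_stack_columns]
        bounded_bilinear.has_vector_derivative[OF bounded_bilinear_matrix_matrix_mult]
        has_vector_derivative_matrix_pow h' A)
  have f_deriv: "(f k has_vector_derivative
      matrix_pow (B t) k *v (v' /\<^sub>R v0) + matrix_pow_deriv (B t) B' k *v (v t /\<^sub>R v0))
      (at t within T)" for k
    unfolding f_eq
    by (intro bounded_bilinear.has_vector_derivative[OF bounded_bilinear_matrix_vector_mult]
        has_vector_derivative_matrix_pow B
        bounded_linear.has_vector_derivative[OF bounded_linear_scaleR_right] v')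
  \<comment> \<open>In each summand one factor is fixed: \<open>h t\<close> or \<open>h'\<close> on
    the left for \<open>G\<close>, a scaled \<open>v t\<close> or \<open>v'\<close> on the right for
    \<open>f\<close>. The other factor tends to zero.\<close>
  note mult_zero = bounded_bilinear.tendsto_right_zero[OF bounded_bilinear_matrix_matrix_mult]
  note vec_zero = bounded_bilinear.tendsto_left_zero[OF bounded_bilinear_matrix_vector_mult]
  note stack_zero = bounded_linear.tendsto_zero[OF bounded_linear_stack_columns]
  have "(\<lambda>k. G k t) \<longlonglongrightarrow> 0"
    unfolding G_eq by (intro stack_zero mult_zero A_lims)
  moreover have "(\<lambda>k. vector_derivative (G k) (at t within T)) \<longlonglongrightarrow> 0"
    unfolding vector_derivative_within[OF nontriv G_deriv]
    by (intro stack_zero tendsto_add_zero mult_zero A_lims)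
  moreover have "(\<lambda>k. f k t) \<longlonglongrightarrow> 0"
    unfolding f_eq by (intro vec_zero B_lims)
  moreover have "(\<lambda>k. vector_derivative (f k) (at t within T)) \<longlonglongrightarrow> 0"
    unfolding vector_derivative_within[OF nontriv f_deriv]
    by (intro tendsto_add_zero vec_zero B_lims)
  moreover have "\<forall>k. G k differentiable (at t within T)" "\<forall>k. f k differentiable (at t within T)"
    using G_deriv f_deriv differentiableI_vector by blast+
  ultimately show "let G = (\<lambda>k \<tau>. stack_columns (ghat s0 (h \<tau>) (\<omega> \<tau>) (v \<tau>) k));
          f = (\<lambda>k \<tau>. fhat \<omega>0 v0 (\<omega> \<tau>) (v \<tau>) k)
      in (\<lambda>k. G k t) \<longlonglongrightarrow> 0 \<and>
         (\<forall>k. G k differentiable (at t within T)) \<and>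
         (\<lambda>k. vector_derivative (G k) (at t within T)) \<longlonglongrightarrow> 0 \<and>
         (\<lambda>k. f k t) \<longlonglongrightarrow> 0 \<and>
         (\<forall>k. f k differentiable (at t within T)) \<and>
         (\<lambda>k. vector_derivative (f k) (at t within T)) \<longlonglongrightarrow> 0"
    unfolding Let_def G_def[symmetric] f_def[symmetric] by blast
qed

end
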